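(* Let $\tau:[0,1)\to[0,\infty]$ be the convergence exponent of partial quotients (defined in the context). Then: (i) $\tau$ is Borel measurable. (ii) For Lebesgue almost every $x\in[0,1)$, $\tau(x)=\infty$. (iii) For every $\alpha\in[0,\infty]$ there exists an irrational $x\in[0,1)$ with $\tau(x)=\alpha$. (iv) For every $\alpha\in[0,\infty]$, the level set $\{x\in[0,1):\tau(x)=\alpha\}$ is uncountable and dense in $[0,1)$. (v) For every interval $I\subseteq[0,1)$ with nonempty interior, $\tau(I)=[0,\infty]$. (vi) $\tau$ is discontinuous at every point of $[0,1)$.
   Context: Every $x\in[0,1)$ has a continued fraction expansion $x=[a_1(x),a_2(x),\dots]=\cfrac{1}{a_1(x)+\cfrac{1}{a_2(x)+\cdots}}$ with positive integer partial quotients $a_n(x)$; the expansion is infinite iff $x$ is irrational, and finite for rational $x$. The convergence exponent of $x$ is $\tau(x):=\inf\{s\ge 0:\sum_{n\ge1}a_n(x)^{-s}<\infty\}\in[0,\infty]$, the sum being over the (finitely or infinitely many) partial quotients of $x$; in particular $\tau(x)=0$ for rational $x$. *)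

theory Defs
  imports "HOL-Analysis.Analysis"
begin

text \<open>The Gauss map. Since \<open>1 / 0 = 0\<close> in HOL, it sends \<open>0\<close> to \<open>0\<close>, as usual.\<close>

definition gauss_map :: "real \<Rightarrow> real" where
  "gauss_map x = frac (1 / x)"

text \<open>Indices start at \<open>0\<close>: \<open>cf_quot x n\<close> is \<open>a\<^bsub>n+1\<^esub>(x)\<close>. It is a genuine partial
  quotient only for \<open>n \<in> cf_indices x\<close>; at the other indices (after the end of the finite
  expansion of a rational number) it has the junk value \<open>0\<close>.\<close>

definition cf_indices :: "real \<Rightarrow> nat set" where
  "cf_indices x = {n. (gauss_map ^^ n) x \<noteq> 0}"

definition cf_quot :: "real \<Rightarrow> nat \<Rightarrow> nat" where
  "cf_quot x n = nat \<lfloor>1 / (gauss_map ^^ n) x\<rfloor>"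

lemma cf_step:
  assumes "0 < x" and "x < 1"
  shows "cf_quot x 0 \<ge> 1" and "gauss_map x \<in> {0..<1}"
    and "x = 1 / (real (cf_quot x 0) + gauss_map x)"
proof -
  have ge: "1 / x \<ge> 1" using assms by simp
  then show "cf_quot x 0 \<ge> 1" by (simp add: cf_quot_def Suc_le_eq)
  show "gauss_map x \<in> {0..<1}" by (simp add: gauss_map_def frac_lt_1)
  have "real (cf_quot x 0) = of_int \<lfloor>1 / x\<rfloor>"
    using assms by (simp add: cf_quot_def)
  then have "real (cf_quot x 0) + gauss_map x = 1 / x"
    by (simp add: gauss_map_def frac_def)
  then show "x = 1 / (real (cf_quot x 0) + gauss_map x)" by simp
qed

lemma cf_quot_Suc: "cf_quot x (Suc n) = cf_quot (gauss_map x) n"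
  by (simp add: cf_quot_def funpow_Suc_right del: funpow.simps)

text \<open>The infimum of the empty set in \<^typ>\<open>ennreal\<close> is \<open>\<infinity>\<close>.\<close>

definition conv_exponent :: "real \<Rightarrow> ennreal" where
  "conv_exponent x =
     Inf {ennreal s | s. 0 \<le> s \<and>
            (\<lambda>n. real (cf_quot x n) powr (- s)) summable_on cf_indices x}"

end

theory Submission
  imports Defs "HOL-Real_Asymp.Real_Asymp"
begin

text \<open>
  The convergence exponent is invariant under the Gauss map \<open>T\<close>, because dropping one term of a
  series does not affect summability. It is a countable infimum over rational \<open>s\<close>, hence
  measurable.

  The set \<open>E\<close> of points without any digit \<open>1\<close> is, up to the point \<open>0\<close>, covered by its images under
  the branches \<open>t \<mapsto> 1 / (k + t)\<close> with \<open>k \<ge> 2\<close>. These contract lengths by \<open>1 / k\<^sup>2\<close>, and the sum of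
  \<open>1 / k\<^sup>2\<close> over \<open>k \<ge> 2\<close> is less than \<open>1\<close>, so \<open>E\<close> is null. Preimages of null sets under \<open>T\<close> are
  null, so almost every expansion has infinitely many digits \<open>1\<close>, and its series diverges for
  every \<open>s\<close>.

  Any sequence of positive integers is the digit sequence of an irrational number. Perturbing
  \<open>1\<close>, \<open>2\<^sup>n\<close> or \<open>n\<close> to the power \<open>1 / \<alpha>\<close> by bounded factors gives uncountably many points with a
  prescribed exponent \<open>\<alpha>\<close>. Replacing the tail of any irrational number by such a point does not
  change the exponent of the latter, so each level set is dense; this also yields the surjectivity
  on intervals and the discontinuity.
\<close>

section \<open>Shift invariance and measurability\<close>

lemma cf_quot_eq_0:
  assumes "n \<notin> cf_indices x"
  shows "cf_quot x n = 0"
  using assms by (simp add: cf_indices_def cf_quot_def)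

text \<open>Off \<open>cf_indices x\<close> the digit is 0, and \<open>0 powr - s\<close> is 0 for
  every s, including s = 0. Hence junk digits add nothing, and for nonnegative terms unconditional
  and ordinary summability agree.\<close>

lemma summable_on_cf_indices_iff:
  "(\<lambda>n. real (cf_quot x n) powr - s) summable_on cf_indices x \<longleftrightarrow>
    summable (\<lambda>n. real (cf_quot x n) powr - s)"
proof -
  have "(\<lambda>n. real (cf_quot x n) powr - s) summable_on cf_indices x \<longleftrightarrow>
    (\<lambda>n. real (cf_quot x n) powr - s) summable_on UNIV"
    by (intro summable_on_cong_neutral) (auto simp: cf_quot_eq_0)
  then show ?thesis
    by (simp add: summable_on_UNIV_nonneg_real_iff)
qed

lemma conv_exponent_eq_Inf:
  "conv_exponent x =
    Inf {ennreal s | s. 0 \<le> s \<and> summable (\<lambda>n. real (cf_quot x n) powr - s)}"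
  by (simp add: conv_exponent_def summable_on_cf_indices_iff)

lemma conv_exponent_gauss_map: "conv_exponent (gauss_map x) = conv_exponent x"
  by (simp add: conv_exponent_eq_Inf cf_quot_Suc[symmetric]
      summable_Suc_iff[of "\<lambda>n. real (cf_quot x n) powr - _"])

text \<open>A natural base is either 0, where both powers are 0, or at least 1, where powers grow
  with the exponent.\<close>

lemma of_nat_powr_neg_antimono:
  assumes "s \<le> t"
  shows "real n powr - t \<le> real n powr - s"
  using assms by (cases "n = 0") (auto intro: powr_mono)

lemma summable_digits_mono:
  fixes b :: "nat \<Rightarrow> nat"
  assumes "summable (\<lambda>n. real (b n) powr - s)" and "s \<le> t"
  shows "summable (\<lambda>n. real (b n) powr - t)"
  using assms(1) by (rule summable_comparison_test'[where N = 0])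
    (use assms(2) in \<open>simp add: of_nat_powr_neg_antimono\<close>)

text \<open>The set of summable exponents is upward closed, so rationals slightly above s suffice.
  The value \<open>\<infinity>\<close> at the remaining q is neutral and makes the index set
  independent of x, as a countable infimum of measurable functions requires.\<close>

lemma conv_exponent_eq_INF_Rats:
  "conv_exponent x = (INF q\<in>\<rat> \<inter> {0..}.
     if summable (\<lambda>n. real (cf_quot x n) powr - q) then ennreal q else \<infinity>)"
  (is "_ = (INF q\<in>_. ?f q)")
proof (rule antisym)
  show "conv_exponent x \<le> (INF q\<in>\<rat> \<inter> {0..}. ?f q)"
    unfolding conv_exponent_eq_Inf by (rule INF_greatest) (auto intro: Inf_lower)
  show "(INF q\<in>\<rat> \<inter> {0..}. ?f q) \<le> conv_exponent x"
    unfolding conv_exponent_eq_Inf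
  proof (rule Inf_greatest, clarify)
    fix s :: real
    assume s: "0 \<le> s" "summable (\<lambda>n. real (cf_quot x n) powr - s)"
    show "(INF q\<in>\<rat> \<inter> {0..}. ?f q) \<le> ennreal s"
    proof (rule ennreal_le_epsilon)
      fix e :: real
      assume "0 < e"
      then obtain q where q: "q \<in> \<rat>" "s < q" "q < s + e"
        using Rats_dense_in_real[of s "s + e"] by auto
      have "(INF q\<in>\<rat> \<inter> {0..}. ?f q) \<le> ?f q"
        using q s by (intro INF_lower) auto
      also have "?f q = ennreal q"
        using summable_digits_mono[OF s(2), of q] q by simp
      also have "\<dots> \<le> ennreal (s + e)"
        using q by (intro ennreal_leI) simp
      also have "\<dots> = ennreal s + ennreal e"
        using s \<open>0 < e\<close> by simp
      finally show "(INF q\<in>\<rat> \<inter> {0..}. ?f q) \<le> ennreal s + ennreal e" .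
    qed
  qed
qed

section \<open>Borel measurability of digits and exponent\<close>

lemma borel_measurable_gauss_map [measurable]: "gauss_map \<in> borel_measurable borel"
  unfolding gauss_map_def[abs_def] frac_def by measurable

lemma borel_measurable_funpow_gauss_map [measurable]:
  "(gauss_map ^^ n) \<in> borel_measurable borel"
  by (induction n) (auto simp: id_def)

lemma borel_measurable_cf_quot [measurable]:
  "(\<lambda>x. real (cf_quot x n)) \<in> borel_measurable borel"
  unfolding cf_quot_def by measurable

text \<open>Turns convergence at a fixed exponent into finiteness of an \<open>ennreal\<close> sum,
  which is a measurable condition on x.\<close>

lemma summable_iff_suminf_ennreal:
  fixes f :: "nat \<Rightarrow> real"
  assumes "\<And>n. 0 \<le> f n"
  shows "summable f \<longleftrightarrow> (\<Sum>n. ennreal (f n)) < \<infinity>"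
proof
  show "(\<Sum>n. ennreal (f n)) < \<infinity>" if "summable f"
    using suminf_ennreal2[OF assms that] by simp
  show "summable f" if "(\<Sum>n. ennreal (f n)) < \<infinity>"
    using that by (intro summable_suminf_not_top assms) auto
qed

lemma borel_measurable_conv_exponent: "conv_exponent \<in> borel_measurable borel"
proof -
  have "countable (\<rat> \<inter> {0::real..})"
    by (simp add: countable_rat)
  then show ?thesis
    unfolding conv_exponent_eq_INF_Rats[abs_def]
    by (intro borel_measurable_INF) (simp_all add: summable_iff_suminf_ennreal)
qed

section \<open>Almost every expansion contains infinitely many digits 1\<close>

text \<open>Change of variables for the constant function 1: the measure of the image is the
  integral of \<open>\<bar>g' x\<bar>\<close> over S.\<close>

lemma measure_deriv_image_le:
  fixes g :: "real \<Rightarrow> real"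
  assumes S: "S \<in> lmeasurable"
    and der: "\<And>x. x \<in> S \<Longrightarrow> (g has_field_derivative g' x) (at x within S)"
    and inj: "inj_on g S"
    and meas: "g' \<in> borel_measurable (lebesgue_on S)"
    and bound: "\<And>x. x \<in> S \<Longrightarrow> \<bar>g' x\<bar> \<le> B"
  shows "g ` S \<in> lmeasurable" and "measure lebesgue (g ` S) \<le> B * measure lebesgue S"
proof -
  have SL: "S \<in> sets lebesgue"
    using S by (rule fmeasurableD)
  have intB: "(\<lambda>x. B) integrable_on S"
    using S by (simp add: integrable_on_const)
  have abs: "(\<lambda>x. \<bar>g' x\<bar> * 1) absolutely_integrable_on S"
    by (rule measurable_bounded_by_integrable_imp_absolutely_integrable[OF _ SL intB])
      (use meas bound in auto)
  have *: "(\<lambda>x. 1::real) absolutely_integrable_on g ` S"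
    "integral (g ` S) (\<lambda>x. 1::real) = integral S (\<lambda>x. \<bar>g' x\<bar> * 1)"
    using has_absolute_integral_change_of_variables_1'
      [OF SL der inj, of "\<lambda>x. 1" "integral S (\<lambda>x. \<bar>g' x\<bar> * 1)"] abs by auto
  show meas_image: "g ` S \<in> lmeasurable"
    using *(1) by (simp add: lmeasurable_iff_integrable_on absolutely_integrable_on_def)
  have "measure lebesgue (g ` S) = integral S (\<lambda>x. \<bar>g' x\<bar> * 1)"
    using *(2) meas_image by (simp add: lmeasure_integral)
  also have "\<dots> \<le> integral S (\<lambda>x. B)"
    by (rule integral_le) (use abs bound intB in \<open>auto simp: absolutely_integrable_on_def\<close>)
  also have "\<dots> = B * measure lebesgue S"
    using S by (simp add: lmeasure_integral flip: integral_mult_right)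
  finally show "measure lebesgue (g ` S) \<le> B * measure lebesgue S" .
qed

section \<open>Inverse branches of the Gauss map\<close>

definition cf_branch :: "nat \<Rightarrow> real \<Rightarrow> real" where
  "cf_branch k t = 1 / (real k + t)"

lemma gauss_map_in: "gauss_map x \<in> {0..<1}"
  by (simp add: gauss_map_def frac_lt_1)

lemma cf_branch_in:
  assumes "1 \<le> k" and "0 < t"
  shows "cf_branch k t \<in> {0<..<1}"
  using assms by (simp add: cf_branch_def)

lemma gauss_map_cf_branch:
  assumes "t \<in> {0..<1}"
  shows "gauss_map (cf_branch k t) = t"
  using assms by (simp add: gauss_map_def cf_branch_def frac_unique_iff)

lemma cf_quot_cf_branch:
  assumes "t \<in> {0..<1}"
  shows "cf_quot (cf_branch k t) 0 = k"
proof -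
  have "\<lfloor>real k + t\<rfloor> = int k"
    using assms by (simp add: floor_unique)
  then show ?thesis
    by (simp add: cf_quot_def cf_branch_def)
qed

lemma cf_branch_gauss_map:
  assumes "x \<in> {0<..<1}"
  shows "cf_branch (cf_quot x 0) (gauss_map x) = x"
  using cf_step(3)[of x] assms by (simp add: cf_branch_def)

lemma cf_branch_has_derivative:
  assumes "1 \<le> k" and "0 \<le> t"
  shows "(cf_branch k has_field_derivative - 1 / (real k + t)\<^sup>2) (at t within S)"
  unfolding cf_branch_def[abs_def]
  using assms by (auto intro!: derivative_eq_intros simp: power2_eq_square)

lemma inj_on_cf_branch: "inj_on (cf_branch k) {0..<1}"
  by (rule inj_on_inverseI[of _ gauss_map]) (simp add: gauss_map_cf_branch)

lemma cf_branch_image_measure: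
  assumes k: "1 \<le> k" and S: "S \<in> lmeasurable" "S \<subseteq> {0..<1}"
  shows "cf_branch k ` S \<in> lmeasurable"
    and "measure lebesgue (cf_branch k ` S) \<le> 1 / (real k)\<^sup>2 * measure lebesgue S"
proof -
  have bd: "\<bar>- 1 / (real k + t)\<^sup>2\<bar> \<le> 1 / (real k)\<^sup>2" if "t \<in> S" for t
    using that S k by (auto intro!: divide_left_mono power_mono mult_pos_pos)
  have "(\<lambda>t. - 1 / (real k + t)\<^sup>2) \<in> borel_measurable lborel"
    by measurable
  then have meas: "(\<lambda>t. - 1 / (real k + t)\<^sup>2) \<in> borel_measurable (lebesgue_on S)"
    by (intro measurable_restrict_space1 measurable_completion)
  have der: "(cf_branch k has_field_derivative - 1 / (real k + t)\<^sup>2) (at t within S)" if "t \<in> S" for t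
    using that S(2) k by (intro cf_branch_has_derivative) auto
  note * = measure_deriv_image_le[OF S(1) der inj_on_subset[OF inj_on_cf_branch S(2)] meas bd]
  show "cf_branch k ` S \<in> lmeasurable"
    "measure lebesgue (cf_branch k ` S) \<le> 1 / (real k)\<^sup>2 * measure lebesgue S"
    by (rule *; assumption)+
qed

lemma inverse_square_tail_le:
  "(\<Sum>k. ennreal (1 / (real (k + 2))\<^sup>2)) \<le> ennreal (2 / 3)"
proof -
  \<comment> \<open>compare with the telescoping series of \<open>1 / (m\<^sup>2 - 1/4) = 1 / (m - 1/2) - 1 / (m + 1/2)\<close>\<close>
  define f where "f k = 1 / (real k + 3 / 2)" for k
  have "f \<longlonglongrightarrow> 0"
    unfolding f_def by real_asymp
  then have sums: "(\<lambda>k. f k - f (Suc k)) sums (2 / 3)"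
    using telescope_sums'[of f 0] by (simp add: f_def)
  have nonneg: "0 \<le> f k - f (Suc k)" for k
    by (simp add: f_def frac_le)
  have "1 / (real (k + 2))\<^sup>2 \<le> f k - f (Suc k)" for k
  proof -
    have "f k - f (Suc k) = 1 / ((real k + 3 / 2) * (real k + 5 / 2))"
      by (simp add: f_def field_simps)
    moreover have "(real k + 3 / 2) * (real k + 5 / 2) \<le> (real (k + 2))\<^sup>2"
      by (simp add: power2_eq_square algebra_simps)
    ultimately show ?thesis
      by (auto intro!: divide_left_mono mult_pos_pos)
  qed
  then have "(\<Sum>k. ennreal (1 / (real (k + 2))\<^sup>2)) \<le> (\<Sum>k. ennreal (f k - f (Suc k)))"
    by (intro suminf_le) (auto intro: ennreal_leI)
  also have "\<dots> = ennreal (2 / 3)"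
    using nonneg sums by (rule suminf_ennreal_eq)
  finally show ?thesis .
qed

definition no_digit_one :: "real set" where
  "no_digit_one = {x \<in> {0..<1}. \<forall>n. (gauss_map ^^ n) x \<le> 1 / 2}"

lemma no_digit_one_borel: "no_digit_one \<in> sets borel"
proof -
  have "{x \<in> space borel. x \<in> {0..<1} \<and> (\<forall>n. (gauss_map ^^ n) x \<le> 1 / 2)} \<in> sets borel"
    by measurable
  then show ?thesis
    by (simp add: no_digit_one_def)
qed

lemma no_digit_one_lmeasurable: "no_digit_one \<in> lmeasurable"
proof (rule fmeasurableI2)
  show "{0..1::real} \<in> lmeasurable"
    by simp
qed (use no_digit_one_borel in \<open>auto simp: no_digit_one_def\<close>)

text \<open>A nonzero point that is at most 1/2 has first digit at least 2, and its image under the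
  Gauss map again lies in the set.\<close>

lemma no_digit_one_subset:
  "no_digit_one - {0} \<subseteq> (\<Union>k. cf_branch (k + 2) ` no_digit_one)"
proof
  fix x assume "x \<in> no_digit_one - {0}"
  then have x: "x \<in> {0<..<1}" and small: "(gauss_map ^^ n) x \<le> 1 / 2" for n
    by (auto simp: no_digit_one_def)
  have "x \<le> 1 / 2"
    using small[of 0] by simp
  then have "2 \<le> 1 / x"
    using x by (simp add: field_simps)
  then have "2 \<le> cf_quot x 0"
    by (simp add: cf_quot_def) linarith
  then obtain k where k: "cf_quot x 0 = k + 2"
    using le_Suc_ex by (metis add.commute)
  have "(gauss_map ^^ n) (gauss_map x) \<le> 1 / 2" for n
    using small[of "Suc n"] by (simp add: funpow_swap1)
  then have "gauss_map x \<in> no_digit_one"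
    using gauss_map_in[of x] by (simp add: no_digit_one_def)
  then show "x \<in> (\<Union>k. cf_branch (k + 2) ` no_digit_one)"
    using cf_branch_gauss_map[OF x] k by (metis UNIV_I UN_I imageI)
qed

lemma negligible_no_digit_one: "negligible no_digit_one"
proof -
  let ?E = no_digit_one and ?m = "emeasure lebesgue no_digit_one"
  have sub01: "?E \<subseteq> {0..<1}"
    by (auto simp: no_digit_one_def)
  have fin: "?m = ennreal (measure lebesgue ?E)"
    using no_digit_one_lmeasurable by (simp add: emeasure_eq_measure2)
  have img: "cf_branch (k + 2) ` ?E \<in> lmeasurable"
    "measure lebesgue (cf_branch (k + 2) ` ?E) \<le> 1 / (real (k + 2))\<^sup>2 * measure lebesgue ?E" for k
    using cf_branch_image_measure[of "k + 2", OF _ no_digit_one_lmeasurable sub01] by auto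
  have "?m = emeasure lebesgue (?E - {0})"
    using no_digit_one_lmeasurable by (subst emeasure_Diff_null_set) auto
  also have "\<dots> \<le> emeasure lebesgue (\<Union>k. cf_branch (k + 2) ` ?E)"
    using img(1) by (intro emeasure_mono no_digit_one_subset) auto
  also have "\<dots> \<le> (\<Sum>k. emeasure lebesgue (cf_branch (k + 2) ` ?E))"
    using img(1) by (intro emeasure_subadditive_countably) auto
  also have "\<dots> \<le> (\<Sum>k. ennreal (1 / (real (k + 2))\<^sup>2) * ?m)"
  proof (intro suminf_le)
    fix k
    have "emeasure lebesgue (cf_branch (k + 2) ` ?E)
        = ennreal (measure lebesgue (cf_branch (k + 2) ` ?E))"
      using img(1) by (simp add: emeasure_eq_measure2)
    also have "\<dots> \<le> ennreal (1 / (real (k + 2))\<^sup>2 * measure lebesgue ?E)"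
      using img(2) by (rule ennreal_leI)
    also have "\<dots> = ennreal (1 / (real (k + 2))\<^sup>2) * ?m"
      unfolding fin by (rule ennreal_mult) auto
    finally show "emeasure lebesgue (cf_branch (k + 2) ` ?E)
        \<le> ennreal (1 / (real (k + 2))\<^sup>2) * ?m" .
  qed auto
  also have "\<dots> \<le> ennreal (2 / 3) * ?m"
    unfolding ennreal_suminf_multc by (rule mult_right_mono[OF inverse_square_tail_le]) simp
  also have "\<dots> = ennreal (2 / 3 * measure lebesgue ?E)"
    unfolding fin by (rule ennreal_mult[symmetric]) auto
  \<comment> \<open>The set has finite measure, so this is an inequality between reals, and it
    leaves only measure 0.\<close>
  finally have "measure lebesgue ?E \<le> 2 / 3 * measure lebesgue ?E"
    by (simp add: fin)
  then have "measure lebesgue ?E = 0"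
    using measure_nonneg[of lebesgue ?E] by linarith
  then show ?thesis
    using no_digit_one_lmeasurable by (simp add: negligible_iff_measure)
qed

text \<open>The preimage consists of countably many images of S under differentiable branches, and
  possibly the point 0, which no branch attains. Differentiable images of null sets are
  null.\<close>

lemma negligible_vimage_gauss_map:
  assumes "negligible S"
  shows "negligible (gauss_map -` S \<inter> {0..<1})"
proof -
  have "gauss_map -` S \<inter> {0..<1} \<subseteq> {0} \<union> (\<Union>k. cf_branch (k + 1) ` (S \<inter> {0..<1}))"
  proof clarify
    fix x assume x: "gauss_map x \<in> S" "x \<in> {0..<1}" "x \<notin> (\<Union>k. cf_branch (k + 1) ` (S \<inter> {0..<1}))"
    show "x = 0"
    proof (rule ccontr)
      assume "x \<noteq> 0"
      then have x01: "x \<in> {0<..<1}"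
        using x by auto
      then obtain k where "cf_quot x 0 = k + 1"
        using cf_step(1)[of x] by (metis add.commute greaterThanLessThan_iff le_Suc_ex)
      then have "x = cf_branch (k + 1) (gauss_map x)"
        using cf_branch_gauss_map[OF x01] by simp
      then show False
        using x gauss_map_in[of x] by blast
    qed
  qed
  moreover have "negligible (cf_branch (k + 1) ` (S \<inter> {0..<1}))" for k
  proof (rule negligible_differentiable_image_negligible)
    show "negligible (S \<inter> {0..<1})"
      using assms by (simp add: negligible_Int)
    show "cf_branch (k + 1) differentiable_on S \<inter> {0..<1}"
      unfolding differentiable_on_def
      by (metis Int_iff atLeastLessThan_iff cf_branch_has_derivative le_add2
          real_differentiable_def)
  qed simp
  ultimately show ?thesis
    by (meson negligible_Un negligible_Union_nat negligible_sing negligible_subset)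
qed

lemma negligible_vimage_funpow_gauss_map:
  assumes "negligible S"
  shows "negligible ((gauss_map ^^ n) -` S \<inter> {0..<1})"
proof (induction n)
  case 0
  then show ?case
    using assms by (simp add: negligible_Int)
next
  case (Suc n)
  have "(gauss_map ^^ Suc n) -` S \<inter> {0..<1}
      \<subseteq> gauss_map -` ((gauss_map ^^ n) -` S \<inter> {0..<1}) \<inter> {0..<1}"
    using gauss_map_in by (auto simp: funpow_swap1)
  then show ?case
    using negligible_vimage_gauss_map[OF Suc] negligible_subset by blast
qed

text \<open>Infinitely many terms are at least \<open>M powr - s\<close>, so the terms do not tend
  to 0 for any s. The lower bound 1 on the digits excludes the junk value 0.\<close>

lemma conv_exponent_eq_infinity:
  assumes "0 < M" and "\<exists>\<^sub>\<infinity>n. cf_quot x n \<in> {1..M}"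
  shows "conv_exponent x = \<infinity>"
proof -
  have "\<not> summable (\<lambda>n. real (cf_quot x n) powr - s)" if "0 \<le> s" for s
  proof
    assume "summable (\<lambda>n. real (cf_quot x n) powr - s)"
    then have "(\<lambda>n. real (cf_quot x n) powr - s) \<longlonglongrightarrow> 0"
      by (rule summable_LIMSEQ_zero)
    moreover have "0 < real M powr - s"
      using assms(1) by simp
    ultimately have "\<forall>\<^sub>F n in sequentially. real (cf_quot x n) powr - s < real M powr - s"
      by (rule order_tendstoD(2))
    moreover have "\<exists>\<^sub>F n in sequentially. real M powr - s \<le> real (cf_quot x n) powr - s"
    proof (rule frequently_elim1)
      show "\<exists>\<^sub>F n in sequentially. cf_quot x n \<in> {1..M}"
        using assms(2) by (simp add: cofinite_eq_sequentially)
      show "real M powr - s \<le> real (cf_quot x n) powr - s" if "cf_quot x n \<in> {1..M}" for n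
        using that \<open>0 \<le> s\<close> by (intro powr_mono2') auto
    qed
    ultimately show False
      by (simp add: frequently_def not_le)
  qed
  then have "{ennreal s | s. 0 \<le> s \<and> summable (\<lambda>n. real (cf_quot x n) powr - s)} = {}"
    by blast
  then show ?thesis
    unfolding conv_exponent_eq_Inf by (simp only: Inf_empty infinity_ennreal_def)
qed

lemma AE_conv_exponent_eq_infinity:
  "AE x in lebesgue_on {0..<1}. conv_exponent x = \<infinity>"
proof -
  \<comment> \<open>Outside \<open>?N\<close> no tail of the expansion avoids the digit 1, hence the
    digit 1 recurs beyond every index m.\<close>
  let ?N = "\<Union>n. (gauss_map ^^ n) -` no_digit_one \<inter> {0..<1}"
  have "negligible ?N"
    by (intro negligible_Union_nat negligible_vimage_funpow_gauss_map negligible_no_digit_one)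
  then have "?N \<in> null_sets lebesgue"
    by (simp add: negligible_iff_null_sets)
  moreover have "conv_exponent x = \<infinity>" if x: "x \<in> {0..<1}" "x \<notin> ?N" for x
  proof (rule conv_exponent_eq_infinity)
    show "\<exists>\<^sub>\<infinity>n. cf_quot x n \<in> {1..1}"
      unfolding INFM_nat_le
    proof
      fix m
      have in01: "(gauss_map ^^ n) x \<in> {0..<1}" for n
        using x(1) by (cases n) (auto simp: gauss_map_in[simplified])
      have "(gauss_map ^^ m) x \<notin> no_digit_one"
        using x by blast
      then obtain n where n: "1 / 2 < (gauss_map ^^ n) ((gauss_map ^^ m) x)"
        using in01[of m] by (force simp: no_digit_one_def not_le)
      let ?y = "(gauss_map ^^ (n + m)) x"
      have "1 / 2 < ?y" "?y < 1"
        using n in01[of "n + m"] by (auto simp: funpow_add)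
      then have "\<lfloor>1 / ?y\<rfloor> = 1"
        by (intro floor_unique) (auto simp: field_simps)
      then have "cf_quot x (n + m) = 1"
        by (simp add: cf_quot_def)
      then show "\<exists>n\<ge>m. cf_quot x n \<in> {1..1}"
        by (intro exI[of _ "n + m"]) simp
    qed
  qed simp
  ultimately have "AE x in lebesgue. x \<in> {0..<1} \<longrightarrow> conv_exponent x = \<infinity>"
    by (intro AE_I'[of ?N]) blast+
  then show ?thesis
    by (simp add: AE_restrict_space_iff)
qed

section \<open>Expansions with prescribed digits\<close>

lemma cf_branch_dist:
  assumes "1 \<le> k" and "0 \<le> u" and "0 \<le> v"
  shows "\<bar>cf_branch k u - cf_branch k v\<bar> \<le> \<bar>u - v\<bar>"
proof -
  have "cf_branch k u - cf_branch k v = (v - u) / ((real k + u) * (real k + v))"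
    using assms by (simp add: cf_branch_def field_simps)
  moreover have "1 * 1 \<le> (real k + u) * (real k + v)"
    using assms by (intro mult_mono) auto
  ultimately show ?thesis
    using divide_left_mono[of 1 "(real k + u) * (real k + v)" "\<bar>u - v\<bar>"]
    by (simp add: abs_divide abs_minus_commute)
qed

\<comment> \<open>A single branch is not a uniform contraction (its derivative is \<open>-1\<close> at \<open>0\<close> for \<open>k = 1\<close>).\<close>
lemma cf_branch_cf_branch_dist:
  assumes "1 \<le> k" and "1 \<le> l" and "0 \<le> u" and "0 \<le> v"
  shows "\<bar>cf_branch k (cf_branch l u) - cf_branch k (cf_branch l v)\<bar> \<le> \<bar>u - v\<bar> / 4"
proof -
  \<comment> \<open>Two branches compose to a Moebius map of determinant 1 in t, so a difference of
    values has numerator u - v. Both denominators are at least 2, which gives the factor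
    1/4.\<close>
  have eq: "cf_branch k (cf_branch l t) = (real l + t) / (real k * (real l + t) + 1)" if "0 \<le> t" for t
    using that assms by (simp add: cf_branch_def field_simps)
  let ?p = "\<lambda>t. real k * (real l + t) + 1"
  have p: "2 \<le> ?p t" if "0 \<le> t" for t
  proof -
    have "1 * 1 \<le> real k * (real l + t)"
      using assms that by (intro mult_mono) auto
    then show ?thesis
      by simp
  qed
  have "?p u \<noteq> 0" "?p v \<noteq> 0"
    using p[OF assms(3)] p[OF assms(4)] by auto
  then have "cf_branch k (cf_branch l u) - cf_branch k (cf_branch l v) =
      ((real l + u) * ?p v - (real l + v) * ?p u) / (?p u * ?p v)"
    unfolding eq[OF assms(3)] eq[OF assms(4)] by (rule diff_frac_eq)
  also have "(real l + u) * ?p v - (real l + v) * ?p u = u - v"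
    by (simp add: algebra_simps)
  finally have "cf_branch k (cf_branch l u) - cf_branch k (cf_branch l v) = (u - v) / (?p u * ?p v)" .
  moreover have "2 * 2 \<le> ?p u * ?p v"
    using p[OF assms(3)] p[OF assms(4)] by (intro mult_mono) auto
  ultimately show ?thesis
    using divide_left_mono[of 4 "?p u * ?p v" "\<bar>u - v\<bar>"]
    by (simp add: abs_divide)
qed

text \<open>The finite continued fraction with digits \<open>b 0\<close>, ...,
  \<open>b (n - 1)\<close> and tail t; for t = 0 it is the n-th convergent.\<close>

primrec cf_word :: "(nat \<Rightarrow> nat) \<Rightarrow> nat \<Rightarrow> real \<Rightarrow> real" where
  "cf_word b 0 t = t"
| "cf_word b (Suc n) t = cf_branch (b 0) (cf_word (\<lambda>i. b (Suc i)) n t)"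

lemma cf_word_nonneg:
  assumes "\<And>i. 1 \<le> b i" and "0 \<le> t"
  shows "0 \<le> cf_word b n t"
  using assms by (induction n arbitrary: b) (auto simp: cf_branch_def)

lemma cf_word_le_1:
  assumes "\<And>i. 1 \<le> b i" and "t \<in> {0..1}"
  shows "cf_word b n t \<le> 1"
proof (cases n)
  case (Suc m)
  have "0 \<le> cf_word (\<lambda>i. b (Suc i)) m t"
    using assms by (intro cf_word_nonneg) auto
  then show ?thesis
    using assms(1)[of 0] Suc by (simp add: cf_branch_def)
qed (use assms in auto)

lemma cf_word_in:
  assumes "\<And>i. 1 \<le> b i" and "t \<in> {0<..<1}"
  shows "cf_word b n t \<in> {0<..<1}"
  using assms
proof (induction n arbitrary: b)
  case (Suc n)
  have "cf_word (\<lambda>i. b (Suc i)) n t \<in> {0<..<1}"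
    using Suc.prems by (intro Suc.IH) auto
  then show ?case
    using Suc.prems(1)[of 0] cf_branch_in by simp
qed simp

lemma cf_word_add: "cf_word b (m + n) t = cf_word b m (cf_word (\<lambda>i. b (m + i)) n t)"
  by (induction m arbitrary: b) simp_all

text \<open>Digits are peeled off in pairs, each pair gaining 1/4. The leading 2 absorbs the single
  branch left over for odd n, which is only nonexpansive.\<close>

lemma cf_word_dist:
  assumes "\<And>i. 1 \<le> b i" and "0 \<le> u" and "0 \<le> v"
  shows "\<bar>cf_word b n u - cf_word b n v\<bar> \<le> 2 * (1 / 2) ^ n * \<bar>u - v\<bar>"
  using assms(1)
proof (induction n arbitrary: b rule: induct_nat_012)
  case 1
  then show ?case
    using cf_branch_dist[of "b 0" u v] assms by simp
next
  case (ge2 n)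
  let ?b = "\<lambda>i. b (Suc (Suc i))"
  have "\<bar>cf_word b (Suc (Suc n)) u - cf_word b (Suc (Suc n)) v\<bar>
      \<le> \<bar>cf_word ?b n u - cf_word ?b n v\<bar> / 4"
    using ge2.prems assms unfolding cf_word.simps
    by (intro cf_branch_cf_branch_dist cf_word_nonneg) auto
  also have "\<dots> \<le> 2 * (1 / 2) ^ n * \<bar>u - v\<bar> / 4"
    using ge2.IH(1)[of ?b] ge2.prems by (intro divide_right_mono) auto
  finally show ?case
    by (simp add: mult.commute)
qed simp

lemma LIMSEQ_geometric_bound:
  assumes "\<And>n. \<bar>f n - x\<bar> \<le> 2 * (1 / 2) ^ n"
  shows "f \<longlonglongrightarrow> (x::real)"
proof (rule LIM_zero_cancel, rule Lim_null_comparison)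
  show "(\<lambda>n. 2 * (1 / 2) ^ n :: real) \<longlonglongrightarrow> 0"
    by (intro tendsto_mult_right_zero LIMSEQ_power_zero) simp
  show "\<forall>\<^sub>F n in sequentially. norm (f n - x) \<le> 2 * (1 / 2) ^ n"
    using assms by simp
qed

section \<open>Values of infinite continued fractions\<close>

definition cf_value :: "(nat \<Rightarrow> nat) \<Rightarrow> real" where
  "cf_value b = lim (\<lambda>n. cf_word b n 0)"

lemma cf_word_LIMSEQ_cf_value:
  assumes "\<And>i. 1 \<le> b i"
  shows "(\<lambda>n. cf_word b n 0) \<longlonglongrightarrow> cf_value b"
proof -
  have *: "\<bar>cf_word b m 0 - cf_word b n 0\<bar> \<le> 2 * (1 / 2) ^ n" if "n \<le> m" for m n
  proof -
    \<comment> \<open>The m-th convergent is the word of the first n digits applied to this tail,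
      which lies in [0,1].\<close>
    let ?t = "cf_word (\<lambda>i. b (n + i)) (m - n) 0"
    have t: "0 \<le> ?t" "?t \<le> 1"
      using assms by (auto intro!: cf_word_nonneg cf_word_le_1)
    have "cf_word b m 0 = cf_word b n ?t"
      using that by (simp flip: cf_word_add)
    then have "\<bar>cf_word b m 0 - cf_word b n 0\<bar> \<le> 2 * (1 / 2) ^ n * \<bar>?t - 0\<bar>"
      using cf_word_dist[of b ?t 0 n] assms t by simp
    also have "\<dots> \<le> 2 * (1 / 2) ^ n * 1"
      using t by (intro mult_left_mono) auto
    finally show ?thesis
      by simp
  qed
  have "(\<lambda>n. 2 * (1 / 2) ^ n :: real) \<longlonglongrightarrow> 0"
    by (intro tendsto_mult_right_zero LIMSEQ_power_zero) simp
  then have small: "\<exists>N. 2 * (1 / 2) ^ N < e" if "0 < e" for e :: real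
    using order_tendstoD(2)[of "\<lambda>n. 2 * (1 / 2) ^ n" 0 sequentially e] that
    by (blast dest: eventually_happens'[OF sequentially_bot])
  have "Cauchy (\<lambda>n. cf_word b n 0)"
  proof (rule CauchyI')
    fix e :: real
    assume "0 < e"
    then obtain N where N: "2 * (1 / 2) ^ N < e"
      using small by blast
    have "dist (cf_word b m 0) (cf_word b n 0) < e" if "N \<le> m" "m < n" for m n
    proof -
      have "dist (cf_word b m 0) (cf_word b n 0) \<le> 2 * (1 / 2) ^ m"
        using *[of m n] that by (simp add: dist_real_def abs_minus_commute)
      also have "\<dots> \<le> 2 * (1 / 2) ^ N"
        using that by (intro mult_left_mono power_decreasing) auto
      also note N
      finally show ?thesis .
    qed
    then show "\<exists>M. \<forall>m\<ge>M. \<forall>n>m. dist (cf_word b m 0) (cf_word b n 0) < e"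
      by blast
  qed
  then show ?thesis
    unfolding cf_value_def by (simp add: Cauchy_convergent_iff convergent_LIMSEQ_iff)
qed

text \<open>The recursion for \<open>cf_word\<close> passes to the limit, since the branch is
  continuous where its denominator is nonzero.\<close>

lemma cf_value_eq:
  assumes "\<And>i. 1 \<le> b i"
  shows "cf_value b = cf_branch (b 0) (cf_value (\<lambda>i. b (Suc i)))"
    and "0 \<le> cf_value b"
proof -
  have nonneg: "0 \<le> cf_value b" if "\<And>i. 1 \<le> b i" for b
    using cf_word_LIMSEQ_cf_value[OF that] by (rule LIMSEQ_le_const) (use that cf_word_nonneg in auto)
  then show "0 \<le> cf_value b"
    using assms by blast
  let ?b = "\<lambda>i. b (Suc i)"
  have "0 \<le> cf_value ?b"
    using assms by (intro nonneg)
  then have "real (b 0) + cf_value ?b \<noteq> 0"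
    using assms[of 0] by linarith
  then have "(\<lambda>n. cf_word b (Suc n) 0) \<longlonglongrightarrow> cf_branch (b 0) (cf_value ?b)"
    using cf_word_LIMSEQ_cf_value[of ?b] assms
    by (auto simp: cf_branch_def intro!: tendsto_intros)
  moreover have "(\<lambda>n. cf_word b (Suc n) 0) \<longlonglongrightarrow> cf_value b"
    using cf_word_LIMSEQ_cf_value[OF assms] by (rule LIMSEQ_Suc)
  ultimately show "cf_value b = cf_branch (b 0) (cf_value ?b)"
    by (metis LIMSEQ_unique)
qed

lemma cf_value_in:
  assumes "\<And>i. 1 \<le> b i"
  shows "cf_value b \<in> {0<..<1}"
proof -
  \<comment> \<open>The limit itself only yields nonnegativity. One use of the fixed-point equation
    gives positivity; a second use, now with a positive tail, gives a value below 1 even if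
    \<open>b 0 = 1\<close>.\<close>
  have pos: "0 < cf_value b" if "\<And>i. 1 \<le> b i" for b
  proof -
    have "0 \<le> cf_value (\<lambda>i. b (Suc i))"
      using that by (intro cf_value_eq(2))
    then show ?thesis
      using that[of 0] by (subst cf_value_eq(1)[OF that]) (auto simp: cf_branch_def)
  qed
  have "0 < cf_value (\<lambda>i. b (Suc i))"
    using assms by (intro pos)
  then show ?thesis
    using cf_value_eq(1)[of b] assms cf_branch_in by metis
qed

lemma gauss_map_cf_value:
  assumes "\<And>i. 1 \<le> b i"
  shows "gauss_map (cf_value b) = cf_value (\<lambda>i. b (Suc i))"
    and "cf_quot (cf_value b) 0 = b 0"
proof -
  have "cf_value (\<lambda>i. b (Suc i)) \<in> {0<..<1}"
    using assms by (intro cf_value_in)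
  then have t: "cf_value (\<lambda>i. b (Suc i)) \<in> {0..<1}"
    by simp
  have "cf_value b = cf_branch (b 0) (cf_value (\<lambda>i. b (Suc i)))"
    using assms by (rule cf_value_eq(1))
  then show "gauss_map (cf_value b) = cf_value (\<lambda>i. b (Suc i))" "cf_quot (cf_value b) 0 = b 0"
    using gauss_map_cf_branch[OF t] cf_quot_cf_branch[OF t] by metis+
qed

lemma funpow_gauss_map_cf_value:
  assumes "\<And>i. 1 \<le> b i"
  shows "(gauss_map ^^ n) (cf_value b) = cf_value (\<lambda>i. b (n + i))"
  using assms by (induction n) (simp_all add: gauss_map_cf_value)

lemma cf_quot_cf_value:
  assumes "\<And>i. 1 \<le> b i"
  shows "cf_quot (cf_value b) n = b n"
  using assms
proof (induction n arbitrary: b)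
  case 0
  then show ?case
    by (rule gauss_map_cf_value(2))
next
  case (Suc n)
  then show ?case
    by (simp add: cf_quot_Suc gauss_map_cf_value(1))
qed

\<comment> \<open>The Gauss map performs a step of the Euclidean algorithm.\<close>
lemma gauss_map_terminates: "\<exists>n. (gauss_map ^^ n) (real p / real q) = 0"
proof (induction p arbitrary: q rule: less_induct)
  case (less p)
  show ?case
  proof (cases "p = 0")
    case True
    then show ?thesis
      by (intro exI[of _ 0]) simp
  next
    case False
    have "real q / real p = real (q div p) + real (q mod p) / real p"
      using False by (simp add: real_of_nat_div field_simps flip: of_nat_mult of_nat_add)
    then have "gauss_map (real p / real q) = real (q mod p) / real p"
      using False by (simp add: gauss_map_def frac_unique_iff)
    moreover obtain n where "(gauss_map ^^ n) (real (q mod p) / real p) = 0"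
      using less[of "q mod p" p] False by auto
    ultimately show ?thesis
      by (intro exI[of _ "Suc n"]) (simp add: funpow_swap1)
  qed
qed

text \<open>Every Gauss iterate is the value of a shifted digit sequence and so stays positive,
  whereas the orbit of a rational reaches 0.\<close>

lemma cf_value_irrational:
  assumes "\<And>i. 1 \<le> b i"
  shows "cf_value b \<notin> \<rat>"
proof
  assume "cf_value b \<in> \<rat>"
  then obtain p q where "\<bar>cf_value b\<bar> = real p / real q"
    by (rule Rats_abs_nat_div_natE)
  moreover have "0 \<le> cf_value b"
    using assms by (rule cf_value_eq(2))
  ultimately obtain n where "(gauss_map ^^ n) (cf_value b) = 0"
    using gauss_map_terminates[of p q] by auto
  moreover have "cf_value (\<lambda>i. b (n + i)) \<in> {0<..<1}"
    using assms by (intro cf_value_in)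
  ultimately show False
    by (simp add: funpow_gauss_map_cf_value[OF assms])
qed

section \<open>Level sets\<close>

text \<open>The infimum is determined by the exponents strictly above and strictly below
  \<alpha>.\<close>

lemma conv_exponent_eqI:
  assumes above: "\<And>s. \<lbrakk>0 \<le> s; \<alpha> < ennreal s\<rbrakk> \<Longrightarrow> summable (\<lambda>n. real (cf_quot x n) powr - s)"
    and below: "\<And>s. \<lbrakk>0 \<le> s; ennreal s < \<alpha>\<rbrakk> \<Longrightarrow> \<not> summable (\<lambda>n. real (cf_quot x n) powr - s)"
  shows "conv_exponent x = \<alpha>"
proof (rule antisym)
  show "\<alpha> \<le> conv_exponent x"
    unfolding conv_exponent_eq_Inf
    by (rule Inf_greatest) (use below in \<open>force simp: not_less[symmetric]\<close>)
  show "conv_exponent x \<le> \<alpha>"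
  \<comment> \<open>A point w strictly between \<alpha> and z is finite, hence a real exponent to
    which \<open>above\<close> applies.\<close>
  proof (rule dense_ge)
    fix z
    assume "\<alpha> < z"
    then obtain w where w: "\<alpha> < w" "w < z"
      using dense by blast
    then obtain s where s: "0 \<le> s" "w = ennreal s"
      using less_top_ennreal by (metis order_less_le_trans top_greatest)
    then have "conv_exponent x \<le> w"
      unfolding conv_exponent_eq_Inf using above[of s] w by (intro Inf_lower) auto
    then show "conv_exponent x \<le> z"
      using w by simp
  qed
qed

text \<open>The constant 1 diverges for every s, \<open>2 ^ n\<close> gives a geometric series of
  ratio \<open>2 powr - s\<close>, and the power 1/a gives a p-series with p = s/a. Rounding to
  integer digits comes later.\<close>

lemma exists_sequence_exponent:
  fixes \<alpha> :: ennreal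
  obtains c :: "nat \<Rightarrow> real" where "\<And>n. 1 \<le> c n"
    and "\<And>s. \<lbrakk>0 \<le> s; \<alpha> < ennreal s\<rbrakk> \<Longrightarrow> summable (\<lambda>n. c n powr - s)"
    and "\<And>s. \<lbrakk>0 \<le> s; ennreal s < \<alpha>\<rbrakk> \<Longrightarrow> \<not> summable (\<lambda>n. c n powr - s)"
proof (cases \<alpha>)
  case top
  show ?thesis
    by (rule that[of "\<lambda>_. 1"]) (simp_all add: top summable_const_iff)
next
  case (real a)
  show ?thesis
  proof (cases "a = 0")
    case True
    have "(2 ^ n) powr - s = (2 powr - s) ^ n" for n and s :: real
      by (simp add: powr_powr mult.commute flip: powr_realpow)
    moreover have "2 powr - s < 1" if "0 < s" for s :: real
      using that powr_less_mono[of "- s" 0 2] by simp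
    ultimately show ?thesis
      by (intro that[of "\<lambda>n. 2 ^ n"]) (use True real in \<open>auto simp: summable_geometric_iff\<close>)
  next
    case False
    with real have a: "0 < a"
      by simp
    \<comment> \<open>The shift to \<open>Suc n\<close> makes the first term 1 instead of 0.\<close>
    have "summable (\<lambda>n. (real (Suc n) powr (1 / a)) powr - s) \<longleftrightarrow> a < s" for s
      using a summable_Suc_iff[of "\<lambda>n. real n powr - (s / a)"]
      by (simp add: powr_powr summable_real_powr_iff)
    then show ?thesis
      by (intro that[of "\<lambda>n. real (Suc n) powr (1 / a)"])
        (use a real in \<open>auto simp: ge_one_powr_ge_zero ennreal_less_iff\<close>)
  qed
qed

lemma uncountable_level_set_irrational:
  "uncountable {x \<in> {0..<1} - \<rat>. conv_exponent x = \<alpha>}" (is "uncountable ?L")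
proof -
  obtain c :: "nat \<Rightarrow> real" where c1: "\<And>n. 1 \<le> c n"
    and above: "\<And>s. \<lbrakk>0 \<le> s; \<alpha> < ennreal s\<rbrakk> \<Longrightarrow> summable (\<lambda>n. c n powr - s)"
    and below: "\<And>s. \<lbrakk>0 \<le> s; ennreal s < \<alpha>\<rbrakk> \<Longrightarrow> \<not> summable (\<lambda>n. c n powr - s)"
    using exists_sequence_exponent by blast
  \<comment> \<open>Adding the indicator of A codes an arbitrary set of naturals into the digits,
    and A can be read back from them.\<close>
  define b where "b A n = nat \<lceil>c n\<rceil> + of_bool (n \<in> A)" for A n
  have real_b: "real (b A n) = of_int \<lceil>c n\<rceil> + of_bool (n \<in> A)" for A n
    using c1[of n] by (simp add: b_def)
  \<comment> \<open>Rounding up and the indicator each add at most 1, and c + 2 \<le> 3c because c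
    \<ge> 1.\<close>
  have bounds: "c n \<le> real (b A n)" "real (b A n) \<le> 3 * c n" for A n
    using c1[of n] ceiling_correct[of "c n"] unfolding real_b by (cases "n \<in> A"; simp; linarith)+
  have b1: "1 \<le> b A n" for A n
    using bounds(1)[of n A] c1[of n] by linarith
  have quot: "cf_quot (cf_value (b A)) n = b A n" for A n
    using b1 by (rule cf_quot_cf_value)
  have "conv_exponent (cf_value (b A)) = \<alpha>" for A
  proof (rule conv_exponent_eqI)
    fix s :: real
    assume s: "0 \<le> s" "\<alpha> < ennreal s"
    show "summable (\<lambda>n. real (cf_quot (cf_value (b A)) n) powr - s)"
    proof (rule summable_comparison_test'[OF above[OF s], where N = 0])
      fix n
      have "real (b A n) powr - s \<le> c n powr - s"
        using bounds(1)[of n A] c1[of n] s by (intro powr_mono2') auto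
      then show "norm (real (cf_quot (cf_value (b A)) n) powr - s) \<le> c n powr - s"
        by (simp add: quot)
    qed
  next
    fix s :: real
    assume s: "0 \<le> s" "ennreal s < \<alpha>"
    show "\<not> summable (\<lambda>n. real (cf_quot (cf_value (b A)) n) powr - s)"
    proof
      assume "summable (\<lambda>n. real (cf_quot (cf_value (b A)) n) powr - s)"
      \<comment> \<open>The factor \<open>3 powr s\<close> offsets the upper bound 3c on the
        digits.\<close>
      then have "summable (\<lambda>n. 3 powr s * real (b A n) powr - s)"
        by (simp add: quot)
      then have "summable (\<lambda>n. c n powr - s)"
      proof (rule summable_comparison_test'[where N = 0])
        fix n
        have "(3 * c n) powr - s \<le> real (b A n) powr - s"
          using bounds(1)[of n A] bounds(2)[of A n] c1[of n] s by (intro powr_mono2') auto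
        then have "3 powr s * (3 powr - s * c n powr - s) \<le> 3 powr s * real (b A n) powr - s"
          using c1[of n] by (simp add: powr_mult)
        also have "3 powr s * (3 powr - s * c n powr - s) = c n powr - s"
          by (simp add: powr_minus)
        finally show "norm (c n powr - s) \<le> 3 powr s * real (b A n) powr - s"
          by simp
      qed
      then show False
        using below[OF s] by contradiction
    qed
  qed
  moreover have "cf_value (b A) \<in> {0<..<1}" "cf_value (b A) \<notin> \<rat>" for A
    using b1 by (rule cf_value_in cf_value_irrational)+
  ultimately have sub: "range (\<lambda>A. cf_value (b A)) \<subseteq> ?L"
    by (auto simp: less_imp_le)
  have inj: "inj (\<lambda>A. cf_value (b A))"
  proof (rule injI)
    fix A B
    assume "cf_value (b A) = cf_value (b B)"
    then have "b A n = b B n" for n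
      using quot[of A n] quot[of B n] by simp
    then have "n \<in> A \<longleftrightarrow> n \<in> B" for n
      unfolding b_def by (metis (full_types) add_left_imp_eq of_bool_eq(1,2) zero_neq_one)
    then show "A = B"
      by blast
  qed
  have "uncountable (UNIV :: nat set set)"
    unfolding uncountable_def using Cantors_theorem[of "UNIV :: nat set"] by auto
  then show ?thesis
    using countable_image_inj_eq[OF inj] countable_subset[OF sub] by blast
qed

lemma exists_irrational_conv_exponent: "\<exists>x\<in>{0..<1}. x \<notin> \<rat> \<and> conv_exponent x = \<alpha>"
proof -
  have "{x \<in> {0..<1} - \<rat>. conv_exponent x = \<alpha>} \<noteq> {}"
    using uncountable_level_set_irrational[of \<alpha>] countable_empty by metis
  then show ?thesis
    by blast
qed

section \<open>Density of the level sets\<close>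

lemma gauss_map_irrational:
  assumes "x \<notin> \<rat>"
  shows "gauss_map x \<notin> \<rat>"
proof
  assume "gauss_map x \<in> \<rat>"
  then have "gauss_map x + of_int \<lfloor>1 / x\<rfloor> \<in> \<rat>"
    by simp
  then have "inverse (1 / x) \<in> \<rat>"
    by (intro Rats_inverse) (simp add: gauss_map_def frac_def)
  then show False
    using assms by simp
qed

text \<open>Irrationality keeps the orbit away from 0, so every digit is genuine and x is recovered
  from its first n digits and its n-th iterate.\<close>

lemma cf_word_gauss_map:
  assumes "x \<in> {0<..<1}" and "x \<notin> \<rat>"
  shows "cf_word (cf_quot x) n ((gauss_map ^^ n) x) = x"
    and "1 \<le> cf_quot x n" and "(gauss_map ^^ n) x \<in> {0<..<1}"
proof -
  have step: "gauss_map y \<in> {0<..<1}" if "y \<notin> \<rat>" for y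
  proof -
    have "gauss_map y \<noteq> 0"
      using gauss_map_irrational[OF that] by auto
    then show ?thesis
      using gauss_map_in[of y] by simp
  qed
  have "cf_word (cf_quot x) n ((gauss_map ^^ n) x) = x \<and> 1 \<le> cf_quot x n \<and>
      (gauss_map ^^ n) x \<in> {0<..<1}"
    using assms
  proof (induction n arbitrary: x)
    case 0
    then show ?case
      using cf_step(1)[of x] by simp
  next
    case (Suc n)
    have "cf_word (cf_quot (gauss_map x)) n ((gauss_map ^^ n) (gauss_map x)) = gauss_map x"
      "1 \<le> cf_quot (gauss_map x) n" "(gauss_map ^^ n) (gauss_map x) \<in> {0<..<1}"
      using Suc.IH[of "gauss_map x"] step[OF Suc.prems(2)] gauss_map_irrational[OF Suc.prems(2)]
      by auto
    then show ?case
      using cf_branch_gauss_map[OF Suc.prems(1)] by (simp add: cf_quot_Suc[abs_def] funpow_swap1)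
  qed
  then show "cf_word (cf_quot x) n ((gauss_map ^^ n) x) = x" "1 \<le> cf_quot x n"
    "(gauss_map ^^ n) x \<in> {0<..<1}"
    by auto
qed

text \<open>Each branch prepends one digit, which the Gauss map removes without changing the
  exponent.\<close>

lemma conv_exponent_cf_word:
  assumes "\<And>i. 1 \<le> b i" and "t \<in> {0<..<1}"
  shows "conv_exponent (cf_word b n t) = conv_exponent t"
  using assms(1)
proof (induction n arbitrary: b)
  case (Suc n)
  let ?y = "cf_word (\<lambda>i. b (Suc i)) n t"
  have "?y \<in> {0<..<1}"
    using Suc.prems assms(2) by (intro cf_word_in)
  then have "conv_exponent (cf_branch (b 0) ?y) = conv_exponent ?y"
    using conv_exponent_gauss_map[of "cf_branch (b 0) ?y"] by (simp add: gauss_map_cf_branch)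
  then show ?case
    using Suc by simp
qed simp

lemma irrational_subset_closure_level_set:
  "{0<..<1} - \<rat> \<subseteq> closure {x \<in> {0..<1}. conv_exponent x = \<alpha>}" (is "_ \<subseteq> closure ?L")
proof
  fix x :: real
  assume "x \<in> {0<..<1} - \<rat>"
  then have x: "x \<in> {0<..<1}" "x \<notin> \<rat>"
    by auto
  obtain z where "z \<in> {0..<1}" "z \<notin> \<rat>" and z: "conv_exponent z = \<alpha>"
    using exists_irrational_conv_exponent by blast
  then have z01: "z \<in> {0<..<1}"
    by (cases "z = 0") auto
  \<comment> \<open>\<open>?y n\<close> has the first n digits of x followed by the expansion of z.
    Both x and \<open>?y n\<close> are images of tails in (0,1) under the same word.\<close>
  let ?y = "\<lambda>n. cf_word (cf_quot x) n z"
  have "?y n \<in> {0<..<1}" for n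
    using cf_word_gauss_map(2)[OF x] z01 by (rule cf_word_in)
  then have "?y n \<in> ?L" for n
    using conv_exponent_cf_word[OF cf_word_gauss_map(2)[OF x] z01] z by (auto simp: less_imp_le)
  moreover have "?y \<longlonglongrightarrow> x"
  proof (rule LIMSEQ_geometric_bound)
    fix n
    let ?t = "(gauss_map ^^ n) x"
    have t: "?t \<in> {0<..<1}"
      using x by (rule cf_word_gauss_map(3))
    have "\<bar>?y n - x\<bar> = \<bar>?y n - cf_word (cf_quot x) n ?t\<bar>"
      using cf_word_gauss_map(1)[OF x, of n] by simp
    also have "\<dots> \<le> 2 * (1 / 2) ^ n * \<bar>z - ?t\<bar>"
      using cf_word_gauss_map(2)[OF x] z01 t by (intro cf_word_dist) auto
    also have "\<dots> \<le> 2 * (1 / 2) ^ n * 1"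
      using z01 t by (intro mult_left_mono) auto
    finally show "\<bar>?y n - x\<bar> \<le> 2 * (1 / 2) ^ n"
      by simp
  qed
  ultimately show "x \<in> closure ?L"
    unfolding closure_sequential by (intro exI[of _ ?y]) blast
qed

lemma subset_closure_irrational: "{0..<1::real} \<subseteq> closure ({0<..<1} - \<rat>)"
proof
  fix x :: real
  assume x: "x \<in> {0..<1}"
  show "x \<in> closure ({0<..<1} - \<rat>)"
    unfolding closure_approachable
  proof (intro allI impI)
    fix e :: real
    assume "0 < e"
    \<comment> \<open>Searching only to the right of x, and below 1, stays inside (0,1) even for x =
      0.\<close>
    then have "uncountable {x<..<min (x + e) 1}"
      using x by (simp add: uncountable_open_interval)
    then have "\<not> {x<..<min (x + e) 1} \<subseteq> \<rat>"
      using countable_rat countable_subset by blast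
    then obtain y where "y \<in> {x<..<min (x + e) 1}" "y \<notin> \<rat>"
      by blast
    then show "\<exists>y\<in>{0<..<1} - \<rat>. dist y x < e"
      using x by (intro bexI[of _ y]) (auto simp: dist_real_def)
  qed
qed

lemma subset_closure_level_set:
  "{0..<1} \<subseteq> closure {x \<in> {0..<1}. conv_exponent x = \<alpha>}"
  using subset_closure_irrational closure_minimal[OF irrational_subset_closure_level_set closed_closure]
  by blast

section \<open>Surjectivity on intervals and discontinuity\<close>

lemma conv_exponent_image_eq_UNIV:
  assumes "I \<subseteq> {0..<1}" and "interior I \<noteq> {}"
  shows "conv_exponent ` I = UNIV"
proof -
  have "\<alpha> \<in> conv_exponent ` I" for \<alpha>
  proof -
    have "interior I \<inter> closure {x \<in> {0..<1}. conv_exponent x = \<alpha>} \<noteq> {}"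
      using assms subset_closure_level_set[of \<alpha>] interior_subset[of I] by blast
    then have "interior I \<inter> {x \<in> {0..<1}. conv_exponent x = \<alpha>} \<noteq> {}"
      by (simp add: open_Int_closure_eq_empty)
    then show ?thesis
      using interior_subset[of I] by auto
  qed
  then show ?thesis
    by blast
qed

lemma not_continuous_conv_exponent:
  assumes "x \<in> {0..<1}"
  shows "\<not> continuous (at x within {0..<1}) conv_exponent"
proof
  assume cont: "continuous (at x within {0..<1}) conv_exponent"
  obtain \<alpha> :: ennreal where \<alpha>: "conv_exponent x \<noteq> \<alpha>"
    by (metis zero_neq_one)
  \<comment> \<open>This is a neighbourhood of \<open>conv_exponent x\<close>. Continuity would keep
    nearby values inside it, yet \<alpha> is attained arbitrarily close to x.\<close>
  have "open (- {\<alpha>})"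
    by (simp add: open_Compl)
  then obtain A where A: "open A" "x \<in> A" "\<And>y. y \<in> {0..<1} \<Longrightarrow> y \<in> A \<Longrightarrow> conv_exponent y \<noteq> \<alpha>"
    using cont \<alpha> unfolding continuous_within_topological by (metis ComplD ComplI singletonD singletonI)
  have "x \<in> closure {y \<in> {0..<1}. conv_exponent y = \<alpha>}"
    using assms subset_closure_level_set by blast
  then show False
    using A open_Int_closure_eq_empty[of A "{y \<in> {0..<1}. conv_exponent y = \<alpha>}"] by blast
qed

theorem theorem2p1:
  shows "conv_exponent \<in> borel_measurable (restrict_space borel {0..<1}) \<and>
    (AE x in lebesgue_on {0..<1}. conv_exponent x = \<infinity>) \<and>
    (\<forall>\<alpha>::ennreal. \<exists>x\<in>{0..<1}. x \<notin> \<rat> \<and> conv_exponent x = \<alpha>) \<and>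
    (\<forall>\<alpha>::ennreal. uncountable {x \<in> {0..<1}. conv_exponent x = \<alpha>} \<and>
       {0..<1} \<subseteq> closure {x \<in> {0..<1}. conv_exponent x = \<alpha>}) \<and>
    (\<forall>I. is_interval I \<and> I \<subseteq> {0..<1} \<and> interior I \<noteq> {} \<longrightarrow> conv_exponent ` I = UNIV) \<and>
    (\<forall>x\<in>{0..<1}. \<not> continuous (at x within {0..<1}) conv_exponent)"
proof (intro conjI allI ballI impI)
  show "conv_exponent \<in> borel_measurable (restrict_space borel {0..<1})"
    using borel_measurable_conv_exponent by (rule measurable_restrict_space1)
  show "AE x in lebesgue_on {0..<1}. conv_exponent x = \<infinity>"
    by (rule AE_conv_exponent_eq_infinity)
  fix \<alpha> :: ennreal
  show "\<exists>x\<in>{0..<1}. x \<notin> \<rat> \<and> conv_exponent x = \<alpha>"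
    by (rule exists_irrational_conv_exponent)
  show "uncountable {x \<in> {0..<1}. conv_exponent x = \<alpha>}"
    using uncountable_level_set_irrational[of \<alpha>] by (rule contrapos_nn) (auto elim: countable_subset[rotated])
  show "{0..<1} \<subseteq> closure {x \<in> {0..<1}. conv_exponent x = \<alpha>}"
    by (rule subset_closure_level_set)
qed (simp_all add: conv_exponent_image_eq_UNIV not_continuous_conv_exponent)

end
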